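(* Let $2\leq m<n$ be integers. Then the resultant of $\Psi_m(x,y)$ and $\Psi_n(x,y)$ with respect to $x$ is $$\begin{cases} p^{\varphi(m)}\,y^{\varphi(m)\varphi(n)}&\text{if } n/m=p^\alpha \text{ for some prime } p \text{ and some positive integer } \alpha;\\ y^{\varphi(m)\varphi(n)}&\text{otherwise}. \end{cases}$$
   Context: The Fibonacci polynomials are defined by $F_1(x)=1$, $F_2(x)=x$, and $F_n(x)=xF_{n-1}(x)+F_{n-2}(x)$ for $n\geq 3$. For $n\geq 2$, the $n$-th fibotomic polynomial $\Psi_n(x)\in\mathbb{Z}[x]$ is the product of the monic irreducible factors of $F_n(x)$ which are not factors of $F_k(x)$ for any $k<n$; also $\Psi_1(x)=1$. Thus $F_n(x)=\prod_{d\mid n}\Psi_d(x)$ for all $n\geq1$, and for $n\geq 2$, $\Psi_n(x)$ is monic of degree $\varphi(n)$, where $\varphi$ is Euler's totient function. The homogenized fibotomic polynomials are $\Psi_1(x,y)=1$ and $\Psi_n(x,y)=y^{\varphi(n)}\Psi_n(x/y)$ for $n\geq2$; these are homogeneous of degree $\varphi(n)$ and monic in $x$. For monic polynomials $f,g$ (in $x$) with roots $a_1,\dots,a_r$ and $b_1,\dots,b_s$ respectively, the resultant is $\textup{res}(f,g)=\prod_{i,j}(a_i-b_j)$. *)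

theory Defs
  imports "HOL-Computational_Algebra.Polynomial_Factorial"
          "HOL-Number_Theory.Number_Theory"
          "Subresultants.Resultant_Prelim"
begin

(* Fibonacci polynomials: F_1 = 1, F_2 = x, F_n = x F_{n-1} + F_{n-2};
   F_0 = 0 is only an auxiliary value (consistent with the recursion). *)
fun fib_poly :: "nat \<Rightarrow> int poly" where
  "fib_poly 0 = 0"
| "fib_poly (Suc 0) = 1"
| "fib_poly (Suc (Suc n)) = [:0, 1:] * fib_poly (Suc n) + fib_poly n"

definition fibotomic :: "nat \<Rightarrow> int poly" where
  "fibotomic n = (if n \<le> 1 then 1 else
     \<Prod> {p. monic p \<and> irreducible p \<and> p dvd fib_poly n \<and>
            (\<forall>k\<in>{1..<n}. \<not> p dvd fib_poly k)})"

(* Homogenized fibotomic polynomial Psi_n(x,y) = y^phi(n) Psi_n(x/y), represented as a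
   polynomial in x whose coefficients are polynomials in y (int poly poly). *)
definition hom_fibotomic :: "nat \<Rightarrow> int poly poly" where
  "hom_fibotomic n = (if n \<le> 1 then 1 else
     (\<Sum>i\<le>totient n. monom (monom (coeff (fibotomic n) i) (totient n - i)) i))"

end

theory Submission
  imports Defs "HOL-Computational_Algebra.Fundamental_Theorem_Algebra"
    "HOL-Computational_Algebra.Squarefree"
begin

text \<open>
  For monic \<open>f\<close> the resultant of \<open>f\<close> and \<open>g\<close> is the product of the values of \<open>g\<close> at the complex
  roots of \<open>f\<close>. Hence it is multiplicative in \<open>g\<close>, depends only on \<open>g\<close> modulo \<open>f\<close>, is \<open>\<plusminus>1\<close> when
  \<open>f\<close> and \<open>g\<close> generate the unit ideal of \<open>\<int>[x]\<close>, and homogenization only contributes a power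
  of \<open>y\<close>.

  The ideal \<open>(F\<^sub>m, F\<^sub>n)\<close> is \<open>(F\<^sub>g)\<close> with \<open>g = gcd m n\<close>. Dividing by \<open>F\<^sub>g\<close> shows that \<open>\<Psi>\<^sub>m\<close> and
  \<open>\<Psi>\<^sub>n\<close> are comaximal if neither index divides the other. If \<open>n = k m\<close>, the congruence
  \<open>F\<^sub>k\<^sub>m / F\<^sub>m \<equiv> k F\<^sub>m\<^sub>+\<^sub>1\<^sup>k\<^sup>-\<^sup>1\<close> modulo \<open>F\<^sub>m\<close> gives that the product of \<open>\<bar>res(\<Psi>\<^sub>m, \<Psi>\<^sub>m\<^sub>e)\<bar>\<close> over the
  divisors \<open>e > 1\<close> of \<open>k\<close> is \<open>k\<close> to the power \<open>\<phi>(m)\<close>. Comparing logarithms with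
  \<open>ln k = \<Sum>\<Lambda>(e)\<close> (sum over \<open>e dvd k\<close>) identifies each factor with \<open>exp (\<phi>(m) \<Lambda>(e))\<close>.

  The sign is positive because \<open>\<Psi>\<^sub>n\<close> is positive on the reals for \<open>n \<ge> 3\<close>, while the
  non-real roots of \<open>\<Psi>\<^sub>m\<close> come in conjugate pairs.
\<close>

subsection \<open>Resultants with a monic polynomial\<close>

text \<open>Reads each row as the coefficient vector of a shifted copy of \<open>p\<close> or
  \<open>q\<close>, highest degree first, so that row operations become polynomial
  identities.\<close>

lemma sylvester_mat_index_coeff:
  fixes p q :: "'a :: comm_semiring_1 poly"
  assumes "i < degree p + degree q" and "j < degree p + degree q"
  shows "sylvester_mat p q $$ (i, j) =
    coeff (if i < degree q then monom 1 (degree q - 1 - i) * p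
           else monom 1 (degree p + degree q - 1 - i) * q) (degree p + degree q - 1 - j)"
proof (cases "i < degree q")
  case True
  then show ?thesis
    using assms by (auto simp: sylvester_index_mat coeff_monom_mult intro!: arg_cong[of _ _ "coeff p"] coeff_eq_0)
next
  case False
  then show ?thesis
    using assms by (auto simp: sylvester_index_mat coeff_monom_mult intro!: arg_cong[of _ _ "coeff q"] coeff_eq_0)
qed

lemma det_unit_upper_triangular:
  fixes A :: "'a :: comm_ring_1 mat"
  assumes A: "A \<in> carrier_mat n n"
    and "\<And>i j. j < i \<Longrightarrow> i < n \<Longrightarrow> A $$ (i, j) = 0"
    and "\<And>i. i < n \<Longrightarrow> A $$ (i, i) = 1"
  shows "det A = 1"
proof -
  have "det A = prod_list (diag_mat A)"
    using assms by (intro det_upper_triangular[of _ n]) auto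
  then show ?thesis
    using assms by (simp add: prod_list_diag_prod)
qed

text \<open>Up to the unitriangular factors \<open>R\<close> and \<open>D\<close>, the Sylvester
  matrix of (X - a) f and g is block triangular, with the Sylvester matrix of f and g and the entry
  g(a) on the diagonal.\<close>

lemma resultant_linear_factor_left:
  fixes f g :: "'a :: idom poly"
  assumes "f \<noteq> 0"
  shows "resultant ([:- a, 1:] * f) g = poly g a * resultant f g"
proof -
  define n M h where "n = degree g" and "M = degree f + degree g" and "h = synthetic_div g a"
  define p where "p = [:- a, 1:] * f"
  have deg_p: "degree p = Suc (degree f)"
    unfolding p_def using assms by (subst degree_mult_eq) auto
  define r where "r i = (if i < n then monom 1 (n - 1 - i) * p else monom 1 (M - i) * g)" for i
  define r' where "r' i = (if i < n then monom 1 (n - 1 - i) * f else monom 1 (M - 1 - i) * g)" for i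
  define S S' where "S = sylvester_mat p g" and "S' = sylvester_mat f g"
  define R where "R = mat (Suc M) (Suc M) (\<lambda>(i, k).
    (if k = i then 1 else 0) + (if k = Suc i then if n \<le> i then - a else 0 else 0))"
  define D where "D = mat (Suc M) (Suc M) (\<lambda>(k, j).
    (if k = j then 1 else 0) + (if Suc k = j then - a else 0))"
  \<comment> \<open>With g = (X - a) h + g(a), the pair (h, g(a)) is the preimage of the last row g
    under (q, c) -> (X - a) q + c; it forms the bottom row of \<open>B\<close>.\<close>
  define w where "w = mat 1 M (\<lambda>(i, j). coeff h (M - 1 - j))"
  define B where "B = four_block_mat S' (0\<^sub>m M 1) w (mat 1 1 (\<lambda>_. poly g a))"
  have S: "S \<in> carrier_mat (Suc M) (Suc M)" and S': "S' \<in> carrier_mat M M"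
    and R: "R \<in> carrier_mat (Suc M) (Suc M)" and D: "D \<in> carrier_mat (Suc M) (Suc M)"
    and w: "w \<in> carrier_mat 1 M"
    by (auto simp: S_def S'_def R_def D_def w_def deg_p M_def intro!: carrier_matI)
  have B: "B \<in> carrier_mat (Suc M) (Suc M)"
    using S' w unfolding B_def by (auto intro!: carrier_matI)
  have S_index: "S $$ (i, j) = coeff (r i) (M - j)" if "i < Suc M" "j < Suc M" for i j
    using that sylvester_mat_index_coeff[of i p g j] by (simp add: S_def r_def deg_p n_def M_def)
  have S'_index: "S' $$ (i, j) = coeff (r' i) (M - 1 - j)" if "i < M" "j < M" for i j
    using that sylvester_mat_index_coeff[of i f g j] by (simp add: S'_def r'_def n_def M_def)
  have g_eq: "g = [:- a, 1:] * h + [:poly g a:]"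
    using synthetic_div_correct'[of a g] by (simp add: h_def)
  have rows: "r i + (if n \<le> i then smult (- a) (r (Suc i)) else 0) = [:- a, 1:] * r' i" if "i < M" for i
  proof (cases "i < n")
    case True
    then show ?thesis by (simp add: r_def r'_def p_def algebra_simps)
  next
    case False
    then have "M - i = Suc (M - 1 - i)" using that by simp
    then have "monom 1 (M - i) = [:0, 1:] * (monom 1 (M - 1 - i) :: 'a poly)"
      by (simp add: monom_Suc)
    with False that show ?thesis
      by (simp add: r_def r'_def algebra_simps)
  qed
  \<comment> \<open>In column 0, multiplication by X - a also involves the coefficient of X^M, for
    which \<open>B\<close> has no entry; it has to vanish here and for \<open>h\<close>.\<close>
  have r'_top: "coeff (r' i) M = 0" if "i < M" for i
    using that unfolding r'_def n_def M_def
    by (auto simp: coeff_monom_mult intro!: coeff_eq_0)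
  have h_top: "coeff h M = 0"
  proof (cases "n = 0")
    case True
    then have "h = 0" by (simp add: h_def n_def synthetic_div_eq_0_iff)
    then show ?thesis by simp
  next
    case False
    then show ?thesis
      by (intro coeff_eq_0) (simp add: h_def degree_synthetic_div n_def M_def)
  qed
  have RS: "(R * S) $$ (i, j) = S $$ (i, j) + (if n \<le> i \<and> i < M then - a * S $$ (Suc i, j) else 0)"
    if "i < Suc M" "j < Suc M" for i j
  proof -
    have "(R * S) $$ (i, j) = (\<Sum>k<Suc M. R $$ (i, k) * S $$ (k, j))"
      using that R S by (auto simp: scalar_prod_def atLeast0LessThan intro!: sum.cong)
    also have "\<dots> = (\<Sum>k<Suc M. (if k = i then S $$ (k, j) else 0)
        + (if k = Suc i then (if n \<le> i then - a * S $$ (k, j) else 0) else 0))"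
      using that by (intro sum.cong) (auto simp: R_def)
    finally show ?thesis
      using that by (auto simp: sum.distrib simp del: sum.lessThan_Suc)
  qed
  have BD: "(B * D) $$ (i, j) = B $$ (i, j) + (if j > 0 then - a * B $$ (i, j - 1) else 0)"
    if "i < Suc M" "j < Suc M" for i j
  proof -
    have "(B * D) $$ (i, j) = (\<Sum>k<Suc M. B $$ (i, k) * D $$ (k, j))"
      using that B D by (auto simp: scalar_prod_def atLeast0LessThan intro!: sum.cong)
    also have "\<dots> = (\<Sum>k<Suc M. (if k = j then B $$ (i, k) else 0)
        + (if k = j - 1 then (if j > 0 then - a * B $$ (i, k) else 0) else 0))"
      using that by (intro sum.cong) (auto simp: D_def)
    finally show ?thesis
      using that by (auto simp: sum.distrib simp del: sum.lessThan_Suc)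
  qed
  \<comment> \<open>\<open>D\<close> encodes \<open>(q, c) \<mapsto> (X - a) q + c\<close> on coefficients, and \<open>R\<close> replaces each row
    \<open>X\<^sup>t g\<close> with \<open>t > 0\<close> by \<open>(X - a) X\<^sup>t\<^sup>-\<^sup>1 g\<close>.\<close>
  have "R * S = B * D"
  proof (rule eq_matI)
    fix i j assume "i < dim_row (B * D)" "j < dim_col (B * D)"
    then have i: "i < Suc M" and j: "j < Suc M" using B D by auto
    show "(R * S) $$ (i, j) = (B * D) $$ (i, j)"
    proof (cases "i < M")
      case True
      have Bi: "B $$ (i, k) = (if k < M then coeff (r' i) (M - 1 - k) else 0)" if "k < Suc M" for k
        using that True S' w by (auto simp: B_def S'_index)
      have "(R * S) $$ (i, j) = coeff ([:- a, 1:] * r' i) (M - j)"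
        unfolding rows[OF True, symmetric] RS[OF i j] using True i j by (simp add: S_index)
      also have "\<dots> = (B * D) $$ (i, j)"
        unfolding BD[OF i j] using j r'_top[OF True]
        by (auto simp: Bi coeff_pCons split: nat.split intro!: arg_cong[of _ _ "coeff (r' i)"])
      finally show ?thesis .
    next
      case False
      then have iM: "i = M" using i by simp
      have Bi: "B $$ (i, k) = (if k < M then coeff h (M - 1 - k) else poly g a)" if "k < Suc M" for k
        using that S' w by (auto simp: B_def w_def iM)
      have "r i = g" by (simp add: r_def n_def M_def iM)
      then have "(R * S) $$ (i, j) = coeff g (M - j)"
        unfolding RS[OF i j] S_index[OF i j] by (simp add: iM)
      also have "\<dots> = coeff ([:- a, 1:] * h + [:poly g a:]) (M - j)"
        using g_eq by simp
      also have "\<dots> = (B * D) $$ (i, j)"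
        unfolding BD[OF i j] using j h_top
        by (auto simp: Bi coeff_pCons split: nat.split intro!: arg_cong[of _ _ "coeff h"])
      finally show ?thesis .
    qed
  qed (use R S B D in auto)
  then have "det R * det S = det B * det D"
    using det_mult[OF R S] det_mult[OF B D] by simp
  moreover have "det R = 1"
    using R by (rule det_unit_upper_triangular) (auto simp: R_def)
  moreover have "det D = 1"
    using D by (rule det_unit_upper_triangular) (auto simp: D_def)
  moreover have "det B = det S' * poly g a"
    unfolding B_def using S' w
    by (subst det_four_block_mat_upper_right_zero_col[of _ M]) (auto simp: det_single)
  ultimately show ?thesis
    by (simp add: resultant_def S_def S'_def p_def)
qed

lemma resultant_linear_factors_left:
  fixes g :: "'a :: idom poly"
  shows "resultant (\<Prod>a\<leftarrow>as. [:- a, 1:]) g = (\<Prod>a\<leftarrow>as. poly g a)"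
proof (induction as)
  case (Cons a as)
  have "(\<Prod>a\<leftarrow>as. [:- a, 1:]) \<noteq> 0" by (auto simp: prod_list_zero_iff)
  then show ?case 
    using Cons by (simp add: resultant_linear_factor_left del: mult_pCons_left)
qed simp

lemma monic_complex_poly_linear_factors:
  fixes p :: "complex poly"
  assumes "monic p"
  obtains as where "p = (\<Prod>a\<leftarrow>as. [:- a, 1:])" and "length as = degree p"
proof -
  have "p \<noteq> 0" using assms by auto
  then obtain A where A: "size A = degree p" "p = smult (lead_coeff p) (\<Prod>x\<in>#A. [:- x, 1:])"
    using alg_closed_imp_factorization by blast
  obtain as where as: "mset as = A" using ex_mset by blast
  have "p = (\<Prod>x\<in>#A. [:- x, 1:])" using A(2) assms by simp
  also have "\<dots> = (\<Prod>a\<leftarrow>as. [:- a, 1:])"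
    by (simp add: as[symmetric] flip: mset_map prod_mset_prod_list)
  finally show ?thesis using that[of as] as A(1) by auto
qed

lemma int_resultant_complex_roots:
  fixes f g :: "int poly"
  assumes "of_int_poly f = (\<Prod>a\<leftarrow>as. [:- a, 1 :: complex:])"
  shows "of_int (resultant f g) = (\<Prod>a\<leftarrow>as. poly (of_int_poly g) a)"
proof -
  have "of_int (resultant f g) = resultant (of_int_poly f :: complex poly) (of_int_poly g)"
    by (simp add: of_int_hom.resultant_hom)
  then show ?thesis by (simp add: assms resultant_linear_factors_left)
qed

lemma monic_int_poly_complex_roots:
  fixes f :: "int poly"
  assumes "monic f"
  obtains as where "of_int_poly f = (\<Prod>a\<leftarrow>as. [:- a, 1 :: complex:])" and "length as = degree f"
proof -
  have "monic (of_int_poly f :: complex poly)" using assms by simp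
  then obtain as where "of_int_poly f = (\<Prod>a\<leftarrow>as. [:- a, 1 :: complex:])"
    and "length as = degree (of_int_poly f :: complex poly)"
    by (rule monic_complex_poly_linear_factors)
  moreover have "degree (of_int_poly f :: complex poly) = degree f" by simp
  ultimately show ?thesis using that by metis
qed

section \<open>Multiplicativity and reduction modulo the monic polynomial\<close>

lemma resultant_mult_right:
  fixes f g h :: "int poly"
  assumes "monic f"
  shows "resultant f (g * h) = resultant f g * resultant f h"
proof -
  obtain as where as: "of_int_poly f = (\<Prod>a\<leftarrow>as. [:- a, 1 :: complex:])"
    using monic_int_poly_complex_roots[OF assms] .
  have "(\<Prod>a\<leftarrow>as. poly (of_int_poly (g * h)) a) =
      (\<Prod>a\<leftarrow>as. poly (of_int_poly g) a) * (\<Prod>a\<leftarrow>as. poly (of_int_poly h) a)"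
    by (induction as) (simp_all add: hom_distribs)
  then have "(of_int (resultant f (g * h)) :: complex) = of_int (resultant f g * resultant f h)"
    by (simp add: int_resultant_complex_roots[OF as])
  then show ?thesis by (simp only: of_int_eq_iff)
qed

lemma resultant_power_right:
  fixes f g :: "int poly"
  assumes "monic f"
  shows "resultant f (g ^ k) = resultant f g ^ k"
  by (induction k) (simp_all add: resultant_mult_right[OF assms])

lemma resultant_prod_right:
  fixes f :: "int poly"
  assumes "monic f"
  shows "resultant f (\<Prod>i\<in>I. g i) = (\<Prod>i\<in>I. resultant f (g i))"
  by (induction I rule: infinite_finite_induct) (simp_all add: resultant_mult_right[OF assms])

lemma resultant_cong_right:
  fixes f g h :: "int poly"
  assumes "monic f" and "f dvd g - h"
  shows "resultant f g = resultant f h"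
proof -
  obtain as where as: "of_int_poly f = (\<Prod>a\<leftarrow>as. [:- a, 1 :: complex:])"
    using monic_int_poly_complex_roots[OF assms(1)] .
  obtain q where "g - h = f * q" using assms(2) by blast
  then have g: "g = f * q + h" by (simp add: algebra_simps)
  have root: "poly (of_int_poly f) a = 0" if "a \<in> set as" for a :: complex
    using that by (auto simp: as poly_prod_list prod_list_zero_iff)
  have "(of_int (resultant f g) :: complex) = of_int (resultant f h)"
    unfolding int_resultant_complex_roots[OF as] g
    by (intro arg_cong[of _ _ prod_list] map_cong) (simp_all add: hom_distribs root)
  then show ?thesis by (simp only: of_int_eq_iff)
qed

text \<open>Modulo \<open>f\<close> the product v g is 1, so res(f, v) res(f, g) = res(f, 1) = 1 in
  the integers.\<close>

lemma abs_resultant_comaximal: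
  fixes f g u v :: "int poly"
  assumes "monic f" and "u * f + v * g = 1"
  shows "\<bar>resultant f g\<bar> = 1"
proof -
  have "f dvd v * g - 1"
    using assms(2) by (intro dvdI[of _ _ "- u"]) (simp add: algebra_simps)
  then have "resultant f v * resultant f g = 1"
    using resultant_cong_right[OF assms(1)] resultant_mult_right[OF assms(1)] by fastforce
  then show ?thesis using zmult_eq_1_iff by force
qed

section \<open>Sign of the resultant\<close>

text \<open>Induction on the degree of \<open>f\<close>: a real root x splits off the factor g(x) >=
  0, and a non-real root z together with its conjugate splits off |g(z)|^2.\<close>

lemma real_resultant_nonneg:
  fixes f g :: "real poly"
  assumes "monic f" and g: "\<And>x. poly g x \<ge> 0"
  shows "resultant f g \<ge> 0"
proof -
  interpret real_hom: map_poly_comm_ring_hom complex_of_real ..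
  show ?thesis using assms(1)
  proof (induction "degree f" arbitrary: f rule: less_induct)
    case less
    show ?case
    proof (cases "degree f = 0")
      case True
      with less.prems have "f = 1" using monic_degree_0 by blast
      then show ?thesis by simp
    next
      case False
      then have "degree (map_poly complex_of_real f) > 0" by simp
      then obtain z where z: "poly (map_poly complex_of_real f) z = 0"
        using alg_closed_imp_poly_has_root by blast
      show ?thesis
      proof (cases "Im z = 0")
        case True
        then have "z = of_real (Re z)" by (simp add: complex_eq_iff)
        with z have "poly f (Re z) = 0"
          by (metis of_real_hom.poly_map_poly of_real_eq_0_iff)
        then obtain h where h: "f = [:- Re z, 1:] * h"
          using poly_eq_0_iff_dvd by blast
        then have "monic h" using less.prems by (auto simp: lead_coeff_mult simp del: mult_pCons_left)
        moreover from this have "h \<noteq> 0" by auto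
        moreover from this have "degree f = Suc (degree h)"
          unfolding h by (subst degree_mult_eq) auto
        ultimately show ?thesis
          using less.hyps[of h] g by (simp add: h resultant_linear_factor_left del: mult_pCons_left)
      next
        case False
        define q where "q = [:(Re z)\<^sup>2 + (Im z)\<^sup>2, - 2 * Re z, 1:]"
        have q: "map_poly complex_of_real q = [:- z, 1:] * [:- cnj z, 1:]"
          by (simp add: q_def complex_eq_iff power2_eq_square)
        \<comment> \<open>The remainder is at most linear, has real coefficients and vanishes at the
          non-real z, so it is 0. This gives the factor (X - z)(X - cnj z) over the reals.\<close>
        define r where "r = f mod q"
        have deg_r: "degree r < 2"
          using degree_mod_less'[of q f] by (cases "r = 0") (auto simp: r_def q_def)
        then have r_eq: "r = [:coeff r 0, coeff r 1:]"
          by (intro poly_eqI) (auto simp: coeff_pCons coeff_eq_0 split: nat.split)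
        have "f = q * (f div q) + r" by (simp add: r_def)
        then have "map_poly complex_of_real f =
            map_poly of_real q * map_poly of_real (f div q) + map_poly of_real r"
          by (metis real_hom.hom_add real_hom.hom_mult)
        with z have "poly (map_poly complex_of_real r) z = 0"
          by (simp add: q del: mult_pCons_left)
        then have "poly (map_poly complex_of_real [:coeff r 0, coeff r 1:]) z = 0"
          using r_eq by simp
        then have "complex_of_real (coeff r 0) + z * of_real (coeff r 1) = 0"
          by (simp add: of_real_hom.map_poly_pCons_hom)
        then have "coeff r 0 + Re z * coeff r 1 = 0" "Im z * coeff r 1 = 0"
          by (simp_all add: complex_eq_iff)
        with False have "coeff r 0 = 0" "coeff r 1 = 0" by auto
        then have "r = 0" using r_eq by simp
        then obtain h where h: "f = q * h" unfolding r_def by auto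
        have "monic q" by (simp add: q_def)
        with h less.prems have "monic h" by (auto simp: lead_coeff_mult)
        then have "h \<noteq> 0" by auto
        have "degree f = degree q + degree h"
          unfolding h using \<open>h \<noteq> 0\<close> by (intro degree_mult_eq) (auto simp: q_def)
        then have "degree h < degree f" by (simp add: q_def)
        with less.hyps \<open>monic h\<close> have nonneg: "resultant h g \<ge> 0" by blast
        define G where "G = map_poly complex_of_real g"
        have "complex_of_real (resultant f g) =
            resultant ([:- z, 1:] * ([:- cnj z, 1:] * map_poly of_real h)) G"
          unfolding of_real_hom.resultant_hom[symmetric] h G_def
          by (simp only: real_hom.hom_mult q mult.assoc)
        also have "\<dots> = poly G z * (poly G (cnj z) * resultant (map_poly of_real h) G)"
          using \<open>h \<noteq> 0\<close> by (simp add: resultant_linear_factor_left del: mult_pCons_left)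
        also have "poly G (cnj z) = cnj (poly G z)"
          by (rule poly_cnj_real[symmetric]) (simp add: G_def)
        also have "poly G z * (cnj (poly G z) * resultant (map_poly of_real h) G) =
            of_real ((cmod (poly G z))\<^sup>2 * resultant h g)"
          unfolding of_real_mult complex_norm_square by (simp add: G_def of_real_hom.resultant_hom)
        finally have "resultant f g = (cmod (poly G z))\<^sup>2 * resultant h g"
          by (simp only: of_real_eq_iff)
        with nonneg show ?thesis by simp
      qed
    qed
  qed
qed

lemma int_resultant_nonneg:
  fixes f g :: "int poly"
  assumes "monic f" and "\<And>x :: real. poly (of_int_poly g) x \<ge> 0"
  shows "resultant f g \<ge> 0"
proof -
  have "resultant (of_int_poly f :: real poly) (of_int_poly g) \<ge> 0"
    using assms by (intro real_resultant_nonneg) auto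
  then show ?thesis by (simp add: of_int_hom.resultant_hom)
qed

subsection \<open>Homogenization\<close>

text \<open>The outer variable is x and the inner one y, as in \<open>hom_fibotomic\<close>. The
  term a y is \<open>monom a 1\<close>, so the linear form x - a y is
  \<open>[:- monom a 1, 1:]\<close>.\<close>

definition homogenize :: "'a :: comm_ring_1 poly \<Rightarrow> 'a poly poly" where
  "homogenize f = (\<Sum>i\<le>degree f. monom (monom (coeff f i) (degree f - i)) i)"

lemma coeff_homogenize: "coeff (homogenize f) i = monom (coeff f i) (degree f - i)"
  by (cases "i \<le> degree f") (auto simp: homogenize_def coeff_sum coeff_eq_0)

lemma homogenize_linear_factor:
  fixes f :: "'a :: idom poly"
  assumes "f \<noteq> 0"
  shows "homogenize ([:- a, 1:] * f) = [:- monom a 1, 1:] * homogenize f"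
proof (rule poly_eqI)
  fix i
  have deg: "degree ([:- a, 1:] * f) = Suc (degree f)"
    using assms by (subst degree_mult_eq) auto
  show "coeff (homogenize ([:- a, 1:] * f)) i = coeff ([:- monom a 1, 1:] * homogenize f) i"
  proof (cases i)
    case 0
    then show ?thesis
      unfolding coeff_homogenize deg by (simp add: coeff_homogenize mult_monom minus_monom)
  next
    case (Suc k)
    \<comment> \<open>The two exponents of y differ only where subtraction truncates, and there the
      coefficient is 0.\<close>
    have "Suc (degree f - Suc k) = degree f - k \<or> coeff f (Suc k) = 0"
      by (cases "Suc k \<le> degree f") (auto simp: coeff_eq_0)
    with Suc show ?thesis
      unfolding coeff_homogenize deg
      by (auto simp: coeff_homogenize mult_monom minus_monom add_monom diff_monom)
  qed
qed

lemma homogenize_linear_factors: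
  fixes as :: "'a :: idom list"
  shows "homogenize (\<Prod>a\<leftarrow>as. [:- a, 1:]) = (\<Prod>a\<leftarrow>as. [:- monom a 1, 1:])"
proof (induction as)
  case Nil
  show ?case by (simp add: homogenize_def one_pCons monom_0)
next
  case (Cons a as)
  have "(\<Prod>a\<leftarrow>as. [:- a, 1:]) \<noteq> 0" by (auto simp: prod_list_zero_iff)
  then show ?case 
    using Cons by (simp add: homogenize_linear_factor del: mult_pCons_left)
qed

text \<open>Substituting x = a y turns every term into a multiple of the same power y^(deg
  g).\<close>

lemma poly_homogenize_monom:
  fixes g :: "'a :: comm_ring_1 poly"
  shows "poly (homogenize g) (monom a 1) = monom (poly g a) (degree g)"
proof -
  have "poly (homogenize g) (monom a 1) = (\<Sum>i\<le>degree g. monom (coeff g i * a ^ i) (degree g))"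
    unfolding homogenize_def poly_sum
    by (intro sum.cong) (simp_all add: poly_monom monom_power mult_monom)
  also have "\<dots> = monom (poly g a) (degree g)"
    by (simp add: poly_altdef monom_hom.hom_sum)
  finally show ?thesis .
qed

text \<open>Over the complex numbers the roots a of \<open>f\<close> become roots a y; each of the
  deg f roots contributes g(a) y^(deg g).\<close>

lemma resultant_homogenize:
  fixes f g :: "int poly"
  assumes "monic f"
  shows "resultant (homogenize f) (homogenize g) = monom (resultant f g) (degree f * degree g)"
proof -
  obtain as where as: "of_int_poly f = (\<Prod>a\<leftarrow>as. [:- a, 1 :: complex:])" and len: "length as = degree f"
    using monic_int_poly_complex_roots[OF assms] .
  have hom: "map_poly of_int_poly (homogenize h) = homogenize (of_int_poly h :: complex poly)"
    for h :: "int poly"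
    by (rule poly_eqI) (simp add: coeff_homogenize map_poly_monom coeff_map_poly)
  have "of_int_poly (resultant (homogenize f) (homogenize g)) =
      resultant (homogenize (of_int_poly f)) (homogenize (of_int_poly g :: complex poly))"
    by (simp add: of_int_poly_hom.resultant_hom flip: hom)
  also have "\<dots> = (\<Prod>c\<leftarrow>map (\<lambda>a. monom a 1) as. poly (homogenize (of_int_poly g)) c)"
    unfolding as homogenize_linear_factors
    by (subst resultant_linear_factors_left[symmetric]) (simp add: o_def)
  also have "\<dots> = (\<Prod>a\<leftarrow>as. monom (poly (of_int_poly g) a) (degree g))"
    by (simp add: o_def poly_homogenize_monom del: One_nat_def)
  also have "\<dots> = monom (\<Prod>a\<leftarrow>as. poly (of_int_poly g) a) (length as * degree g)"
    by (induction as) (simp_all add: mult_monom)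
  also have "\<dots> = of_int_poly (monom (resultant f g) (degree f * degree g))"
    by (simp add: int_resultant_complex_roots[OF as, symmetric] len map_poly_monom)
  finally show ?thesis by (simp only: of_int_poly_hom.eq_iff)
qed

subsection \<open>Fibonacci polynomials\<close>

lemma fib_poly_add:
  "fib_poly (Suc (a + b)) = fib_poly (Suc a) * fib_poly (Suc b) + fib_poly a * fib_poly b"
  by (induction a rule: fib_poly.induct) (simp_all add: algebra_simps del: mult_pCons_left)

text \<open>With F_(n+1) - x F_n read as F_(n-1), this is F_(n+1) F_(n-1) - F_n^2 = (-1)^n. The form
  chosen avoids the index n - 1 and so covers n = 0.\<close>

lemma fib_poly_Cassini:
  "fib_poly (Suc n) ^ 2 - [:0, 1:] * fib_poly n * fib_poly (Suc n) - fib_poly n ^ 2 = (- 1) ^ n"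
proof (induction n)
  case (Suc n)
  have "fib_poly (Suc (Suc n)) ^ 2 - [:0, 1:] * fib_poly (Suc n) * fib_poly (Suc (Suc n)) - fib_poly (Suc n) ^ 2
    = - (fib_poly (Suc n) ^ 2 - [:0, 1:] * fib_poly n * fib_poly (Suc n) - fib_poly n ^ 2)"
    unfolding fib_poly.simps by (simp add: algebra_simps power2_eq_square del: mult_pCons_left mult_pCons_right)
  also have "\<dots> = (- 1) ^ Suc n" unfolding Suc.IH by simp
  finally show ?case .
qed simp

text \<open>The Cassini identity times (-1)^n is a Bezout identity with integer coefficients, which
  says more than coprimality in Z[x].\<close>

lemma fib_poly_Suc_comaximal:
  obtains u v where "u * fib_poly n + v * fib_poly (Suc n) = 1"
proof -
  have "(- 1) ^ n * (- ([:0, 1:] * fib_poly (Suc n)) - fib_poly n) * fib_poly n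
      + (- 1) ^ n * fib_poly (Suc n) * fib_poly (Suc n) =
      (- 1) ^ n * (fib_poly (Suc n) ^ 2 - [:0, 1:] * fib_poly n * fib_poly (Suc n) - fib_poly n ^ 2)"
    by (simp add: algebra_simps power2_eq_square del: mult_pCons_left mult_pCons_right)
  also have "\<dots> = 1"
    unfolding fib_poly_Cassini by simp
  finally show ?thesis by (rule that)
qed

text \<open>Subtractive Euclid on the indices: F_(a+c) is F_(a-1) F_c modulo F_a, and F_(a-1) is a
  unit modulo F_a, so (F_a, F_(a+c)) and (F_a, F_c) are the same ideal. Since Z[x] is not a
  principal ideal domain, a gcd alone would not give this.\<close>

lemma fib_poly_bezout: "\<exists>u v. u * fib_poly a + v * fib_poly b = fib_poly (gcd a b)"
proof (induction "a + b" arbitrary: a b rule: less_induct)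
  case less
  have step: "\<exists>u v. u * fib_poly a + v * fib_poly b = fib_poly (gcd a b)"
    if ab: "a \<le> b" "a > 0" and IH: "\<And>c. c < b \<Longrightarrow> \<exists>u v. u * fib_poly a + v * fib_poly c = fib_poly (gcd a c)"
    for a b :: nat
  proof -
    obtain c where b: "b = a + c" using ab(1) le_Suc_ex by blast
    obtain l where l: "a = Suc l" using ab(2) gr0_implies_Suc by blast
    obtain u v where uv: "u * fib_poly a + v * fib_poly c = fib_poly (gcd a c)"
      using IH[of c] ab b by auto
    \<comment> \<open>Here \<open>s\<close> is the inverse of F_(a-1) modulo F_a; it recovers F_c
      from F_b.\<close>
    obtain s t where st: "s * fib_poly l + t * fib_poly a = 1"
      using fib_poly_Suc_comaximal[of l] unfolding l .
    have "fib_poly b = fib_poly a * fib_poly (Suc c) + fib_poly l * fib_poly c"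
      using fib_poly_add[of l c] by (simp add: b l)
    then have "(u - v * s * fib_poly (Suc c) + v * t * fib_poly c) * fib_poly a + (v * s) * fib_poly b
        = u * fib_poly a + v * fib_poly c * (s * fib_poly l + t * fib_poly a)"
      by (simp add: algebra_simps)
    also have "\<dots> = fib_poly (gcd a b)" by (simp add: st uv b)
    finally show ?thesis by blast
  qed
  show ?case
  proof (cases "a = 0 \<or> b = 0")
    case True
    then show ?thesis by (auto intro: exI[of _ 1])
  next
    case False
    show ?thesis
    proof (cases "a \<le> b")
      case True
      show ?thesis by (rule step[OF True _ less.hyps]) (use False in auto)
    next
      case gt: False
      have "\<exists>u v. u * fib_poly b + v * fib_poly a = fib_poly (gcd b a)"
        by (rule step[OF _ _ less.hyps]) (use gt False in auto)
      then obtain u v where "u * fib_poly b + v * fib_poly a = fib_poly (gcd b a)" by blast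
      then have "v * fib_poly a + u * fib_poly b = fib_poly (gcd a b)"
        by (simp add: add.commute gcd.commute)
      then show ?thesis by blast
    qed
  qed
qed

lemma dvd_fib_poly_gcd: "p dvd fib_poly a \<Longrightarrow> p dvd fib_poly b \<Longrightarrow> p dvd fib_poly (gcd a b)"
  using fib_poly_bezout[of a b] by (metis dvd_add dvd_mult)

text \<open>Induction on \<open>k\<close> from the addition formula. The induction also carries
  F_(km+1) = F_(m+1)^k modulo F_m, and F_(m-1) = F_(m+1) modulo F_m lets the two contributions to
  the new quotient combine.\<close>

lemma fib_poly_mult_quotient:
  assumes "m > 0"
  obtains G where "fib_poly (k * m) = fib_poly m * G"
    and "fib_poly m dvd G - of_nat k * fib_poly (Suc m) ^ (k - 1)"
proof -
  obtain l where l: "m = Suc l" using assms gr0_implies_Suc by blast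
  have "\<exists>G A B. fib_poly (k * m) = fib_poly m * G
      \<and> G = of_nat k * fib_poly (Suc m) ^ (k - 1) + fib_poly m * A
      \<and> fib_poly (Suc (k * m)) = fib_poly (Suc m) ^ k + fib_poly m * B"
  proof (induction k)
    case 0
    show ?case by (auto intro!: exI[of _ 0])
  next
    case (Suc k)
    then obtain G A B where G: "fib_poly (k * m) = fib_poly m * G"
      and A: "G = of_nat k * fib_poly (Suc m) ^ (k - 1) + fib_poly m * A"
      and B: "fib_poly (Suc (k * m)) = fib_poly (Suc m) ^ k + fib_poly m * B" by blast
    have 1: "fib_poly (Suc k * m) = fib_poly m * (fib_poly (Suc (k * m)) + G * fib_poly l)"
    proof -
      have "fib_poly (Suc k * m) = fib_poly (Suc (k * m + l))"
        using l by (intro arg_cong[of _ _ fib_poly]) simp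
      also have "\<dots> = fib_poly (Suc (k * m)) * fib_poly m + fib_poly m * G * fib_poly l"
        unfolding fib_poly_add l[symmetric] G ..
      finally show ?thesis by (simp add: algebra_simps)
    qed
    \<comment> \<open>For k = 0 the exponent k - 1 truncates, but the factor \<open>of_nat k\<close>
      makes both sides 0.\<close>
    have pow: "of_nat k * fib_poly (Suc m) ^ (k - 1) * fib_poly (Suc m) = of_nat k * fib_poly (Suc m) ^ k"
      by (cases k) (simp_all add: algebra_simps)
    define H where "H = of_nat k * fib_poly (Suc m) ^ (k - 1)"
    have "fib_poly l = fib_poly (Suc m) - [:0, 1:] * fib_poly m"
      by (simp add: l)
    then have "H * fib_poly l = of_nat k * fib_poly (Suc m) ^ k - H * ([:0, 1:] * fib_poly m)"
      using pow by (simp add: H_def right_diff_distrib)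
    then have "fib_poly (Suc (k * m)) + G * fib_poly l = fib_poly (Suc m) ^ k
        + of_nat k * fib_poly (Suc m) ^ k + fib_poly m * (B + A * fib_poly l - [:0, 1:] * H)"
      unfolding A B H_def[symmetric]
      by (simp add: algebra_simps del: mult_pCons_left mult_pCons_right)
    then have 2: "fib_poly (Suc (k * m)) + G * fib_poly l = of_nat (Suc k) * fib_poly (Suc m) ^ (Suc k - 1)
        + fib_poly m * (B + A * fib_poly l - [:0, 1:] * H)"
      by (simp add: distrib_right)
    have "fib_poly (Suc (Suc k * m)) = fib_poly (Suc (k * m)) * fib_poly (Suc m) + fib_poly (k * m) * fib_poly m"
      using fib_poly_add[of "k * m" m] by (simp add: add.commute)
    also have "\<dots> = fib_poly (Suc m) ^ Suc k + fib_poly m * (B * fib_poly (Suc m) + G * fib_poly m)"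
      unfolding B G by (simp add: algebra_simps)
    finally show ?case using 1 2 by blast
  qed
  then obtain G A where "fib_poly (k * m) = fib_poly m * G"
    and "G - of_nat k * fib_poly (Suc m) ^ (k - 1) = fib_poly m * A"
    by (auto simp: diff_eq_eq add.commute simp del: fib_poly.simps)
  then show ?thesis using that[of G] dvdI by blast
qed

lemma fib_poly_dvd: "m dvd n \<Longrightarrow> fib_poly m dvd fib_poly n"
proof -
  assume "m dvd n"
  then obtain k where "n = k * m" by (metis dvd_def mult.commute)
  show ?thesis
  proof (cases "m = 0")
    case False
    then obtain G where "fib_poly (k * m) = fib_poly m * G"
      using fib_poly_mult_quotient[of m k] by (metis gr0I)
    then show ?thesis unfolding \<open>n = k * m\<close> by (rule dvdI)
  qed (use \<open>m dvd n\<close> in simp)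
qed

lemma degree_fib_poly_Suc: "degree (fib_poly (Suc n)) = n"
  and monic_fib_poly_Suc: "monic (fib_poly (Suc n))"
proof -
  have "degree (fib_poly (Suc n)) \<le> n \<and> coeff (fib_poly (Suc n)) n = 1"
  proof (induction n rule: fib_poly.induct)
    case (3 n)
    have "degree (fib_poly (Suc (Suc (Suc n)))) \<le> Suc (Suc n)"
      unfolding fib_poly.simps(3)[of "Suc n"] using 3
      by (intro degree_add_le) (auto intro: order.trans[OF degree_pCons_le])
    moreover have "coeff (fib_poly (Suc n)) (Suc (Suc n)) = 0"
      using 3 by (intro coeff_eq_0) auto
    ultimately show ?case using 3 by (simp add: fib_poly.simps(3)[of "Suc n"] del: fib_poly.simps(3))
  qed auto
  moreover from this show "degree (fib_poly (Suc n)) = n"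
    by (intro antisym le_degree) auto
  ultimately show "monic (fib_poly (Suc n))" by simp
qed

lemma degree_fib_poly: "degree (fib_poly n) = n - 1"
  by (cases n) (simp_all add: degree_fib_poly_Suc del: fib_poly.simps(3))

lemma monic_fib_poly: "n > 0 \<Longrightarrow> monic (fib_poly n)"
  by (cases n) (simp_all add: monic_fib_poly_Suc del: fib_poly.simps(3))

lemma fib_poly_nonzero: "n > 0 \<Longrightarrow> fib_poly n \<noteq> 0"
  using monic_fib_poly[of n] by auto

section \<open>Squarefreeness of the Fibonacci polynomials\<close>

text \<open>The factor x^2 + 4 is the discriminant of t^2 - x t - 1, the characteristic polynomial
  of the recursion. Modulo F_n the right-hand side is 2n F_(n+1), where F_(n+1) is a unit.\<close>

lemma pderiv_fib_poly:
  "[:4, 0, 1:] * pderiv (fib_poly n) =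
    of_nat (2 * n) * fib_poly (Suc n) - of_nat (n + 1) * [:0, 1:] * fib_poly n"
proof (induction n rule: fib_poly.induct)
  case (3 n)
  define X :: "int poly" where "X = [:0, 1:]"
  define Q :: "int poly" where "Q = [:4, 0, 1:]"
  define N :: "int poly" where "N = of_nat n"
  have Q: "Q = X * X + 4"
    by (simp add: X_def Q_def numeral_poly)
  have D: "pderiv (fib_poly (Suc (Suc n))) =
      fib_poly (Suc n) + X * pderiv (fib_poly (Suc n)) + pderiv (fib_poly n)"
    by (simp add: X_def pderiv_add pderiv_pCons)
  have F: "fib_poly (Suc (Suc (Suc n))) = X * fib_poly (Suc (Suc n)) + fib_poly (Suc n)"
    "fib_poly (Suc (Suc n)) = X * fib_poly (Suc n) + fib_poly n"
    by (simp_all add: X_def)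
  have IH: "Q * pderiv (fib_poly (Suc n)) = (2 * N + 2) * fib_poly (Suc (Suc n)) - (N + 2) * X * fib_poly (Suc n)"
    "Q * pderiv (fib_poly n) = 2 * N * fib_poly (Suc n) - (N + 1) * X * fib_poly n"
    using 3 by (simp_all add: X_def Q_def N_def algebra_simps del: fib_poly.simps mult_pCons_left mult_pCons_right)
  have "Q * pderiv (fib_poly (Suc (Suc n))) = Q * fib_poly (Suc n)
      + X * (Q * pderiv (fib_poly (Suc n))) + Q * pderiv (fib_poly n)"
    unfolding D by (simp add: algebra_simps)
  also have "\<dots> = (2 * N + 4) * fib_poly (Suc (Suc (Suc n))) - (N + 3) * X * fib_poly (Suc (Suc n))"
    unfolding IH unfolding F unfolding Q by (simp add: algebra_simps del: fib_poly.simps)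
  finally show ?case
    by (simp add: X_def Q_def N_def algebra_simps del: fib_poly.simps mult_pCons_left mult_pCons_right)
qed (simp_all add: pderiv_1)

text \<open>If p^2 divides F_n, then p divides F_n and its derivative, hence 2n F_(n+1), hence 2n by
  comaximality. So p is a constant, and a constant dividing a monic polynomial is a unit.\<close>

lemma squarefree_fib_poly:
  assumes "n > 0"
  shows "squarefree (fib_poly n)"
proof (rule squarefreeI)
  fix p :: "int poly" assume "p ^ 2 dvd fib_poly n"
  then obtain q where q: "fib_poly n = p ^ 2 * q" by blast
  have p: "p dvd fib_poly n" unfolding q by (simp add: power2_eq_square)
  have "p dvd pderiv (fib_poly n)"
    unfolding q by (simp add: pderiv_mult power2_eq_square)
  then have "p dvd [:4, 0, 1:] * pderiv (fib_poly n) + of_nat (n + 1) * [:0, 1:] * fib_poly n"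
    using p by (intro dvd_add dvd_mult)
  then have "p dvd of_nat (2 * n) * fib_poly (Suc n)"
    unfolding pderiv_fib_poly by simp
  moreover obtain u v where "u * fib_poly n + v * fib_poly (Suc n) = 1"
    using fib_poly_Suc_comaximal .
  then have "of_nat (2 * n) * (u * fib_poly n + v * fib_poly (Suc n)) = of_nat (2 * n)" by simp
  then have "of_nat (2 * n) = of_nat (2 * n) * u * fib_poly n + v * (of_nat (2 * n) * fib_poly (Suc n))"
    by (simp only: distrib_left ac_simps)
  ultimately have "p dvd of_nat (2 * n)"
    using p dvd_add[OF dvd_mult dvd_mult] by metis
  then have "p dvd [:of_nat (2 * n):]" by (simp only: of_nat_poly)
  then have "degree p = 0"
    using assms by (auto dest!: dvd_imp_degree_le)
  then obtain c where c: "p = [:c:]" using degree_eq_zeroE by blast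
  with p have "c dvd lead_coeff (fib_poly n)" by (simp add: const_poly_dvd_iff)
  then show "is_unit p" using monic_fib_poly[OF assms] by (simp add: c is_unit_const_poly_iff)
qed

subsection \<open>Fibotomic polynomials\<close>

lemma normalize_monic_int_poly:
  fixes p :: "int poly"
  assumes "monic p"
  shows "normalize p = p"
  using assms by (simp add: normalize_poly_eq_map_poly)

text \<open>The leading coefficient divides 1, and normalization fixes its sign.\<close>

lemma monic_if_normalized_dvd_monic:
  fixes p q :: "int poly"
  assumes "normalize p = p" and "p dvd q" and "monic q"
  shows "monic p"
proof -
  have "p \<noteq> 0" using assms(2,3) by auto
  then have "unit_factor p = 1" using assms(1) by (metis unit_factor_normalize)
  then have "sgn (lead_coeff p) = 1"
    by (simp add: unit_factor_poly_def one_pCons)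
  moreover have "lead_coeff p dvd 1"
    using assms(2,3) by (metis dvdE dvd_triv_left lead_coeff_mult)
  ultimately show ?thesis by (auto simp: sgn_if split: if_splits)
qed

text \<open>The predicate \<open>prime\<close> includes being normalized, which for divisors of a
  monic polynomial means monic. This makes unique factorization available.\<close>

lemma fibotomic_eq_prod_prime_factors:
  assumes "n > 0"
  shows "fibotomic n = \<Prod> {p \<in> prime_factors (fib_poly n). \<forall>k\<in>{1..<n}. \<not> p dvd fib_poly k}"
proof (cases "n = 1")
  case True
  then show ?thesis by (simp add: fibotomic_def)
next
  case False
  have "monic p \<and> irreducible p \<longleftrightarrow> prime p" if "p dvd fib_poly n" for p
    using that monic_if_normalized_dvd_monic[OF _ that monic_fib_poly[OF assms]] normalize_monic_int_poly[of p]
    by (auto simp: prime_def prime_elem_iff_irreducible)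
  then show ?thesis
    using False assms fib_poly_nonzero[OF assms] unfolding fibotomic_def
    by (auto simp: in_prime_factors_iff intro!: arg_cong[of _ _ Prod])
qed

text \<open>By squarefreeness F_n is the product of its distinct prime factors. Each of them is
  sorted by the least index d at which it divides F_d, and this d divides n.\<close>

lemma fib_poly_eq_prod_fibotomic:
  assumes "n > 0"
  shows "fib_poly n = (\<Prod>d | d dvd n. fibotomic d)"
proof -
  define A where "A d = {p \<in> prime_factors (fib_poly d). \<forall>k\<in>{1..<d}. \<not> p dvd fib_poly k}" for d
  have nz: "fib_poly n \<noteq> 0" using fib_poly_nonzero[OF assms] .
  have monic: "monic (\<Prod> (prime_factors (fib_poly n)))"
    unfolding lead_coeff_prod
  proof (intro prod.neutral ballI)
    fix p assume "p \<in> prime_factors (fib_poly n)"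
    then show "monic p"
      using monic_fib_poly[OF assms]
      by (intro monic_if_normalized_dvd_monic[of p "fib_poly n"]) (auto simp: in_prime_factors_iff normalize_prime)
  qed
  have "prime_factorization (fib_poly n) = mset_set (prime_factors (fib_poly n))"
    using squarefree_fib_poly[OF assms] unfolding squarefree_factorial_semiring'[OF nz]
    by (intro multiset_eqI) (auto simp: count_mset_set' count_prime_factorization in_prime_factors_iff not_dvd_imp_multiplicity_0)
  then have "normalize (\<Prod> (prime_factors (fib_poly n))) = normalize (fib_poly n)"
    using prod_mset_prime_factorization_weak[OF nz] by (simp add: prod_unfold_prod_mset)
  then have "fib_poly n = \<Prod> (prime_factors (fib_poly n))"
    using normalize_monic_int_poly[OF monic] normalize_monic_int_poly[OF monic_fib_poly[OF assms]] by simp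
  also have "prime_factors (fib_poly n) = (\<Union>d\<in>{d. d dvd n}. A d)"
  proof (intro equalityI subsetI)
    fix p assume "p \<in> prime_factors (fib_poly n)"
    then have p: "prime p" "p dvd fib_poly n" by auto
    define d where "d = (LEAST k. k > 0 \<and> p dvd fib_poly k)"
    have d: "d > 0 \<and> p dvd fib_poly d"
      unfolding d_def by (rule LeastI[of _ n]) (use p assms in simp)
    have d_min: "d \<le> k" if "k > 0" "p dvd fib_poly k" for k
      unfolding d_def by (rule Least_le) (use that in simp)
    \<comment> \<open>The prime also divides F_gcd(d,n), so minimality of d forces gcd(d, n) =
      d.\<close>
    have "d \<le> gcd d n"
      using d p dvd_fib_poly_gcd by (intro d_min) auto
    then have "gcd d n = d" using d by (intro antisym) (auto intro: gcd_le1_nat)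
    then have "d dvd n" by (metis gcd_dvd2)
    moreover have "p \<in> A d"
      unfolding A_def
    proof (intro CollectI conjI ballI notI)
      show "p \<in> prime_factors (fib_poly d)"
        using p d fib_poly_nonzero[of d] by (simp add: in_prime_factors_iff)
    next
      fix k assume "k \<in> {1..<d}" "p dvd fib_poly k"
      then show False using d_min[of k] by simp
    qed
    ultimately show "p \<in> (\<Union>d\<in>{d. d dvd n}. A d)" by blast
  next
    fix p assume "p \<in> (\<Union>d\<in>{d. d dvd n}. A d)"
    then show "p \<in> prime_factors (fib_poly n)"
      using nz fib_poly_dvd by (auto simp: A_def in_prime_factors_iff intro: dvd_trans)
  qed
  also have "\<Prod> (\<Union>d\<in>{d. d dvd n}. A d) = (\<Prod>d | d dvd n. \<Prod> (A d))"
  proof (rule prod.UNION_disjoint)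
    show "\<forall>d\<in>{d. d dvd n}. \<forall>e\<in>{d. d dvd n}. d \<noteq> e \<longrightarrow> A d \<inter> A e = {}"
    proof (intro ballI impI)
      fix d e assume "d \<in> {d. d dvd n}" "e \<in> {d. d dvd n}" "d \<noteq> e"
      moreover from this have "d > 0" "e > 0" using assms by (auto intro: dvd_pos_nat)
      ultimately have "d \<in> {1..<e} \<or> e \<in> {1..<d}" by auto
      then show "A d \<inter> A e = {}" unfolding A_def by blast
    qed
  qed (use assms in \<open>auto simp: A_def\<close>)
  also have "\<dots> = (\<Prod>d | d dvd n. fibotomic d)"
    using assms by (intro prod.cong) (auto simp: A_def fibotomic_eq_prod_prime_factors intro!: dvd_pos_nat)
  finally show ?thesis .
qed

lemma monic_fibotomic: "monic (fibotomic n)"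
proof (cases "n \<le> 1")
  case False
  then show ?thesis unfolding fibotomic_def by (auto simp: lead_coeff_prod intro!: prod.neutral)
qed (simp add: fibotomic_def)

lemma fibotomic_nonzero: "fibotomic n \<noteq> 0"
  using monic_fibotomic[of n] by auto

lemma fibotomic_dvd_fib_poly: "n > 0 \<Longrightarrow> fibotomic n dvd fib_poly n"
  by (subst fib_poly_eq_prod_fibotomic) (auto intro!: dvd_prodI)

text \<open>The uniqueness half of Moebius inversion, by strong induction. Cancellative monoids
  cover both degrees in \<open>nat\<close> and real logarithms.\<close>

lemma divisor_sum_cancel:
  fixes f g :: "nat \<Rightarrow> 'a :: cancel_comm_monoid_add"
  assumes "\<And>n. n > 0 \<Longrightarrow> (\<Sum>d | d dvd n. f d) = (\<Sum>d | d dvd n. g d)" and "n > 0"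
  shows "f n = g n"
  using assms(2)
proof (induction n rule: less_induct)
  case (less n)
  have split: "(\<Sum>d | d dvd n. h d) = h n + (\<Sum>d\<in>{d. d dvd n} - {n}. h d)" for h :: "nat \<Rightarrow> 'a"
    using less.prems by (intro sum.remove) auto
  have "f d = g d" if "d \<in> {d. d dvd n} - {n}" for d
  proof -
    from that have "d dvd n" "d \<noteq> n" by auto
    then show ?thesis
      using less dvd_imp_le[of d n] dvd_pos_nat[of n d] by auto
  qed
  then have "(\<Sum>d\<in>{d. d dvd n} - {n}. f d) = (\<Sum>d\<in>{d. d dvd n} - {n}. g d)"
    by (rule sum.cong[OF refl])
  then show ?case
    using assms(1)[OF less.prems] unfolding split by simp
qed

lemma degree_fibotomic:
  assumes "n \<ge> 2"
  shows "degree (fibotomic n) = totient n"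
proof -
  \<comment> \<open>Index 1 is exceptional: Psi_1 = 1 has degree 0 while the totient of 1 is 1. This
    accounts for the divisor sum n - 1 in place of n.\<close>
  have "degree (fibotomic n) = (if n = 1 then 0 else totient n)"
  proof (rule divisor_sum_cancel[of "\<lambda>n. degree (fibotomic n)" "\<lambda>n. if n = 1 then 0 else totient n"])
    fix n :: nat assume n: "n > 0"
    have split: "(\<Sum>d | d dvd n. h d) = h 1 + (\<Sum>d\<in>{d. d dvd n} - {1}. h d)" for h :: "nat \<Rightarrow> nat"
      using n by (intro sum.remove) auto
    have "(\<Sum>d | d dvd n. degree (fibotomic d)) = degree (\<Prod>d | d dvd n. fibotomic d)"
      by (rule degree_prod_eq_sum_degree[symmetric]) (simp add: fibotomic_nonzero)
    also have "\<dots> = n - 1"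
      using fib_poly_eq_prod_fibotomic[OF n] degree_fib_poly[of n] by simp
    also have "\<dots> = (\<Sum>d\<in>{d. d dvd n} - {1}. totient d)"
      using totient_divisor_sum[of n] unfolding split[of totient] by simp
    also have "\<dots> = (\<Sum>d | d dvd n. if d = 1 then 0 else totient d)"
      unfolding split by (auto intro: sum.cong)
    finally show "(\<Sum>d | d dvd n. degree (fibotomic d)) = (\<Sum>d | d dvd n. if d = 1 then 0 else totient d)" .
  qed (use assms in simp)
  then show ?thesis using assms by simp
qed

lemma hom_fibotomic_eq_homogenize:
  assumes "n \<ge> 2"
  shows "hom_fibotomic n = homogenize (fibotomic n)"
  using assms by (simp add: hom_fibotomic_def homogenize_def degree_fibotomic)

section \<open>Positivity of fibotomic polynomials on the real line\<close>

text \<open>The recursion keeps F_n positive at x > 0, and parity in x transfers nonvanishing to x <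
  0.\<close>

lemma fib_poly_real_root_eq_0:
  fixes x :: real
  assumes "n > 0" and "poly (of_int_poly (fib_poly n)) x = 0"
  shows "x = 0"
proof (rule ccontr)
  assume "x \<noteq> 0"
  define F where "F n x = poly (of_int_poly (fib_poly n)) x" for n and x :: real
  have F: "F 0 x = 0" "F (Suc 0) x = 1" "F (Suc (Suc k)) x = x * F (Suc k) x + F k x" for k x
    by (simp_all add: F_def hom_distribs)
  have pos: "F (Suc k) x > 0 \<and> F k x \<ge> 0" if "x > 0" for k x
    by (induction k) (use that in \<open>auto simp: F intro: add_pos_nonneg\<close>)
  have parity: "F k (- x) = (- 1) ^ Suc k * F k x" for k x
    by (induction k rule: fib_poly.induct) (simp_all add: F algebra_simps)
  have "F n \<bar>x\<bar> > 0" using pos[of "\<bar>x\<bar>" "n - 1"] assms(1) \<open>x \<noteq> 0\<close> by simp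
  then have "F n x \<noteq> 0" using parity[of n x] by (auto simp: abs_if split: if_splits)
  then show False using assms(2) by (simp add: F_def)
qed

text \<open>An irreducible factor vanishing at 0 is an associate of x = F_2, which is excluded from
  Psi_n because 2 < n.\<close>

lemma poly_fibotomic_0_nonzero:
  assumes "n \<ge> 3"
  shows "poly (fibotomic n) 0 \<noteq> 0"
proof
  assume "poly (fibotomic n) 0 = 0"
  then obtain p where "p \<in> prime_factors (fib_poly n)" and p: "\<forall>k\<in>{1..<n}. \<not> p dvd fib_poly k" "poly p 0 = 0"
    using assms by (auto simp: fibotomic_eq_prod_prime_factors poly_prod)
  then have "irreducible p" using prime_elem_imp_irreducible prime_imp_prime_elem in_prime_factors_imp_prime by blast
  obtain q where q: "p = [:0, 1:] * q" using p(2) poly_eq_0_iff_dvd[of p 0] by auto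
  have "\<not> is_unit [:0, 1 :: int:]" by (simp add: is_unit_poly_iff)
  with \<open>irreducible p\<close> q have "is_unit q" using irreducibleD by blast
  then have "p dvd fib_poly 2" unfolding q by (simp add: numeral_2_eq_2 mult_unit_dvd_iff del: mult_pCons_left)
  with p(1) assms show False by auto
qed

text \<open>A negative value and the positive values near infinity would force a root by the
  intermediate value theorem.\<close>

lemma monic_real_poly_pos:
  fixes p :: "real poly"
  assumes "monic p" and "\<And>x. poly p x \<noteq> 0"
  shows "poly p x > 0"
proof (rule ccontr)
  assume "\<not> poly p x > 0"
  then have neg: "poly p x < 0" using assms(2)[of x] by linarith
  obtain b where b: "\<And>y. y \<ge> b \<Longrightarrow> poly p y \<ge> 1"
    using poly_pinfty_gt_lc[of p] assms(1) by auto
  have "poly p (max b (x + 1)) > 0" using b[of "max b (x + 1)"] by simp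
  then show False
    using poly_IVT_pos[of x "max b (x + 1)" p] neg assms(2) by (auto simp: less_max_iff_disj)
qed

lemma poly_fibotomic_pos:
  assumes "n \<ge> 3"
  shows "poly (of_int_poly (fibotomic n)) (x :: real) > 0"
proof (rule monic_real_poly_pos)
  show "monic (of_int_poly (fibotomic n) :: real poly)"
    using monic_fibotomic[of n] by simp
next
  fix x :: real
  show "poly (of_int_poly (fibotomic n)) x \<noteq> 0"
  proof
    assume root: "poly (of_int_poly (fibotomic n)) x = 0"
    obtain q where "fib_poly n = fibotomic n * q"
      using fibotomic_dvd_fib_poly[of n] assms by auto
    then have "poly (of_int_poly (fib_poly n)) x = 0"
      using root by (simp add: hom_distribs)
    then have "x = 0" using fib_poly_real_root_eq_0[of n x] assms by simp
    with root have "poly (fibotomic n) 0 = 0" by (simp add: poly_0_coeff_0)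
    then show False using poly_fibotomic_0_nonzero[OF assms] by simp
  qed
qed

subsection \<open>Resultants of fibotomic polynomials\<close>

lemma resultant_fibotomic_nonneg:
  assumes "n \<ge> 3"
  shows "resultant (fibotomic m) (fibotomic n) \<ge> 0"
  using monic_fibotomic poly_fibotomic_pos[OF assms] by (intro int_resultant_nonneg) (auto intro: less_imp_le)

text \<open>The factor Psi_m of F_m is not among the factors Psi_d with d dividing g. Thus F_g can
  be cancelled from a Bezout identity with Psi_m still present.\<close>

lemma fib_poly_mult_fibotomic_dvd:
  assumes "g dvd m" and "g \<noteq> m" and "m > 0"
  shows "fib_poly g * fibotomic m dvd fib_poly m"
proof -
  have g: "g > 0" using assms by (auto intro: dvd_pos_nat)
  have "\<not> m dvd g" using assms dvd_antisym by blast
  then have "fib_poly g * fibotomic m = (\<Prod>d\<in>insert m {d. d dvd g}. fibotomic d)"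
    using g by (simp add: fib_poly_eq_prod_fibotomic)
  also have "\<dots> dvd (\<Prod>d | d dvd m. fibotomic d)"
    using assms by (intro prod_dvd_prod_subset) (auto intro: dvd_trans)
  finally show ?thesis using fib_poly_eq_prod_fibotomic[OF assms(3)] by simp
qed

lemma abs_resultant_fibotomic_not_dvd:
  assumes "m > 0" "n > 0" "\<not> m dvd n" "\<not> n dvd m"
  shows "\<bar>resultant (fibotomic m) (fibotomic n)\<bar> = 1"
proof -
  define g where "g = gcd m n"
  have g: "g dvd m" "g \<noteq> m" "g dvd n" "g \<noteq> n" "g > 0"
    using assms gcd_dvd1[of m n] gcd_dvd2[of m n] unfolding g_def by (metis, metis, metis, metis, simp)
  obtain a b where a: "fib_poly m = fib_poly g * fibotomic m * a" and b: "fib_poly n = fib_poly g * fibotomic n * b"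
    using fib_poly_mult_fibotomic_dvd g assms by (meson dvdE)
  obtain u v where "u * fib_poly m + v * fib_poly n = fib_poly g"
    using fib_poly_bezout[of m n] unfolding g_def by blast
  then have "fib_poly g * (u * a * fibotomic m + v * b * fibotomic n) = fib_poly g * 1"
    unfolding a b by (simp add: algebra_simps)
  then have "u * a * fibotomic m + v * b * fibotomic n = 1"
    using fib_poly_nonzero[OF g(5)] by (simp only: mult_cancel_left) simp
  then show ?thesis by (rule abs_resultant_comaximal[OF monic_fibotomic])
qed

text \<open>Disposes of the power of F_(m+1) in the congruence for F_(km) / F_m.\<close>

lemma abs_resultant_fibotomic_fib_poly_Suc:
  assumes "m > 0"
  shows "\<bar>resultant (fibotomic m) (fib_poly (Suc m))\<bar> = 1"
proof -
  obtain a where a: "fib_poly m = fibotomic m * a" using fibotomic_dvd_fib_poly[OF assms] by blast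
  obtain u v where "u * fib_poly m + v * fib_poly (Suc m) = 1" using fib_poly_Suc_comaximal .
  then have "u * a * fibotomic m + v * fib_poly (Suc m) = 1" by (simp only: a ac_simps)
  then show ?thesis by (rule abs_resultant_comaximal[OF monic_fibotomic])
qed

text \<open>The resultant of Psi_m with G = F_(km) / F_m is computed twice: from the congruence
  modulo F_m, and from the factorization of G into fibotomic polynomials.\<close>

lemma prod_abs_resultant_fibotomic_multiples:
  assumes "m \<ge> 2" and "k > 0"
  shows "(\<Prod>e\<in>{e. e dvd k} - {1}. \<bar>resultant (fibotomic m) (fibotomic (m * e))\<bar>) = int k ^ totient m"
proof -
  let ?R = "resultant (fibotomic m)"
  have m: "m > 0" using assms by simp
  define S where "S = {d. d dvd k * m} - {d. d dvd m}"
  obtain G where G: "fib_poly (k * m) = fib_poly m * G"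
    and cong: "fib_poly m dvd G - of_nat k * fib_poly (Suc m) ^ (k - 1)"
    using fib_poly_mult_quotient[OF m] .
  have fin: "finite {d. d dvd k * m}" using assms by simp
  have "fib_poly m * G = (\<Prod>d\<in>{d. d dvd k * m}. fibotomic d)"
    using fib_poly_eq_prod_fibotomic[of "k * m"] assms G by simp
  also have "\<dots> = (\<Prod>d\<in>S. fibotomic d) * (\<Prod>d | d dvd m. fibotomic d)"
    unfolding S_def by (rule prod.subset_diff[OF _ fin]) auto
  also have "\<dots> = fib_poly m * (\<Prod>d\<in>S. fibotomic d)"
    by (simp add: fib_poly_eq_prod_fibotomic[OF m])
  finally have G_prod: "G = (\<Prod>d\<in>S. fibotomic d)"
    using fib_poly_nonzero[OF m] by simp
  have "?R G = ?R (of_nat k * fib_poly (Suc m) ^ (k - 1))"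
    using fibotomic_dvd_fib_poly[OF m] cong by (intro resultant_cong_right[OF monic_fibotomic]) (rule dvd_trans)
  \<comment> \<open>The resultant with the constant k is k to the degree of Psi_m.\<close>
  also have "\<dots> = int k ^ totient m * ?R (fib_poly (Suc m)) ^ (k - 1)"
    unfolding resultant_mult_right[OF monic_fibotomic] resultant_power_right[OF monic_fibotomic]
    by (simp add: of_nat_poly degree_fibotomic[OF assms(1)])
  finally have "\<bar>?R G\<bar> = int k ^ totient m"
    by (simp add: abs_mult power_abs abs_resultant_fibotomic_fib_poly_Suc[OF m])
  then have "int k ^ totient m = (\<Prod>d\<in>S. \<bar>?R (fibotomic d)\<bar>)"
    by (simp add: G_prod resultant_prod_right monic_fibotomic abs_prod)
  \<comment> \<open>An index d in \<open>S\<close> that is no multiple of m is incomparable with m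
    under divisibility and contributes 1; the remaining ones are m e with e dividing k and e >
    1.\<close>
  also have "\<dots> = (\<Prod>d\<in>(*) m ` ({e. e dvd k} - {1}). \<bar>?R (fibotomic d)\<bar>)"
  proof (rule prod.mono_neutral_right)
    show "finite S" using fin by (simp add: S_def)
    show "(*) m ` ({e. e dvd k} - {1}) \<subseteq> S" using m by (auto simp: S_def mult.commute)
    show "\<forall>d\<in>S - (*) m ` ({e. e dvd k} - {1}). \<bar>?R (fibotomic d)\<bar> = 1"
    proof
      fix d assume d: "d \<in> S - (*) m ` ({e. e dvd k} - {1})"
      have "\<not> m dvd d"
      proof
        assume "m dvd d"
        then obtain e where e: "d = m * e" by blast
        with d m have "e dvd k" "e \<noteq> 1" by (auto simp: S_def mult.commute)
        with d e show False by blast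
      qed
      moreover have "d > 0" using d assms m by (auto simp: S_def intro: dvd_pos_nat)
      ultimately show "\<bar>?R (fibotomic d)\<bar> = 1"
        using d m by (intro abs_resultant_fibotomic_not_dvd) (auto simp: S_def)
    qed
  qed
  also have "\<dots> = (\<Prod>e\<in>{e. e dvd k} - {1}. \<bar>?R (fibotomic (m * e))\<bar>)"
    using m by (subst prod.reindex) (auto simp: inj_on_def)
  finally show ?thesis by simp
qed

section \<open>Identification with the von Mangoldt function\<close>

lemma ln_abs_resultant_fibotomic_multiple:
  assumes "m \<ge> 2" and "k \<ge> 2"
  shows "resultant (fibotomic m) (fibotomic (m * k)) \<noteq> 0"
    and "ln \<bar>real_of_int (resultant (fibotomic m) (fibotomic (m * k)))\<bar> = totient m * mangoldt k"
proof -
  define r where "r e = \<bar>resultant (fibotomic m) (fibotomic (m * e))\<bar>" for e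
  have prod_r: "(\<Prod>e\<in>{e. e dvd k} - {1}. r e) = int k ^ totient m" if "k > 0" for k
    using prod_abs_resultant_fibotomic_multiples[OF assms(1) that] by (simp add: r_def)
  have r_pos: "r e > 0" if "e \<ge> 2" for e
  proof -
    \<comment> \<open>The wanted factor occurs in a nonzero product; positivity is what allows
      taking logarithms.\<close>
    have "(\<Prod>e\<in>{d. d dvd e} - {1}. r e) \<noteq> 0" using prod_r[of e] that by simp
    moreover have "finite ({d. d dvd e} - {1})" "e \<in> {d. d dvd e} - {1}" using that by auto
    ultimately have "r e \<noteq> 0" using prod_zero_iff by blast
    then show ?thesis by (simp add: r_def)
  qed
  then show "resultant (fibotomic m) (fibotomic (m * k)) \<noteq> 0"
    using assms(2) by (force simp: r_def)
  \<comment> \<open>The product omits e = 1, where \<open>mangoldt\<close> is 0 as well; the value 0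
    turns it into a sum over all divisors.\<close>
  define h where "h e = (if e = 1 then 0 else ln (real_of_int (r e)))" for e
  have "h k = totient m * mangoldt k"
  proof (rule divisor_sum_cancel)
    fix k :: nat assume k: "k > 0"
    have ge2: "e \<ge> 2" if "e \<in> {e. e dvd k} - {1}" for e
      using that k dvd_pos_nat[of k e] by force
    have "(\<Sum>e | e dvd k. h e) = (\<Sum>e\<in>{e. e dvd k} - {1}. h e)"
      using k by (intro sum.mono_neutral_right) (auto simp: h_def)
    also have "\<dots> = (\<Sum>e\<in>{e. e dvd k} - {1}. ln (real_of_int (r e)))"
      by (intro sum.cong) (auto simp: h_def)
    also have "\<dots> = ln (\<Prod>e\<in>{e. e dvd k} - {1}. real_of_int (r e))"
      using ge2 r_pos k by (intro ln_prod[symmetric]) fastforce+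
    also have "(\<Prod>e\<in>{e. e dvd k} - {1}. real_of_int (r e)) = real k ^ totient m"
      using prod_r[OF k] by (metis of_int_of_nat_eq of_int_power of_int_prod)
    also have "ln \<dots> = (\<Sum>e | e dvd k. totient m * mangoldt e)"
      using k mangoldt_sum[of k, where ?'a = real] by (simp add: ln_realpow flip: sum_distrib_left)
    finally show "(\<Sum>e | e dvd k. h e) = (\<Sum>e | e dvd k. totient m * mangoldt e)" .
  qed (use assms in simp)
  then show "ln \<bar>real_of_int (resultant (fibotomic m) (fibotomic (m * k)))\<bar> = totient m * mangoldt k"
    using assms(2) by (simp add: h_def r_def)
qed

lemma resultant_fibotomic_multiple:
  assumes "m \<ge> 2" and "k \<ge> 2"
  shows "real_of_int (resultant (fibotomic m) (fibotomic (m * k))) = exp (totient m * mangoldt k)"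
proof -
  have "3 \<le> m * k" using mult_le_mono[OF assms] by simp
  then have "resultant (fibotomic m) (fibotomic (m * k)) > 0"
    using ln_abs_resultant_fibotomic_multiple(1)[OF assms] resultant_fibotomic_nonneg[of "m * k" m] by linarith
  then show ?thesis
    using ln_abs_resultant_fibotomic_multiple(2)[OF assms] by (metis abs_of_pos exp_ln of_int_0_less_iff)
qed

lemma resultant_fibotomic_prime_power:
  assumes "m \<ge> 2" and "prime p" and "\<alpha> > 0"
  shows "resultant (fibotomic m) (fibotomic (m * p ^ \<alpha>)) = int p ^ totient m"
proof -
  have "p ^ \<alpha> \<ge> 2"
    using assms(2,3) prime_ge_2_nat[of p] self_le_power[of p \<alpha>] by linarith
  then have "real_of_int (resultant (fibotomic m) (fibotomic (m * p ^ \<alpha>))) = exp (totient m * ln (real p))"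
    using resultant_fibotomic_multiple[OF assms(1)] assms(2,3) by simp
  also have "\<dots> = real p ^ totient m"
    using prime_gt_0_nat[OF assms(2)] by (simp add: exp_of_nat_mult)
  finally show ?thesis by (metis of_int_eq_iff of_int_of_nat_eq of_int_power)
qed

text \<open>Either n / m is an integer that is no prime power, so that \<open>mangoldt\<close>
  vanishes there, or neither index divides the other and comaximality leaves only the sign.\<close>

lemma resultant_fibotomic_not_prime_power:
  assumes "m \<ge> 2" and "m < n" and "\<nexists>p \<alpha>. prime p \<and> \<alpha> > 0 \<and> n = m * p ^ \<alpha>"
  shows "resultant (fibotomic m) (fibotomic n) = 1"
proof (cases "m dvd n")
  case True
  then obtain k where k: "n = m * k" by blast
  have "k \<ge> 2" using assms(2) k by (cases k rule: nat.exhaust; cases "k - 1") auto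
  have "\<not> primepow k" using assms(3) k unfolding primepow_def by blast
  then have "real_of_int (resultant (fibotomic m) (fibotomic n)) = 1"
    using resultant_fibotomic_multiple[OF assms(1) \<open>k \<ge> 2\<close>] by (simp add: k mangoldt_def)
  then show ?thesis by simp
next
  case False
  have "\<not> n dvd m" using assms by (auto dest: dvd_imp_le)
  then have "\<bar>resultant (fibotomic m) (fibotomic n)\<bar> = 1"
    using False assms by (intro abs_resultant_fibotomic_not_dvd) auto
  then show ?thesis using resultant_fibotomic_nonneg[of n m] assms by simp
qed

theorem theorem2:
  fixes m n :: nat
  assumes "2 \<le> m" and "m < n"
  shows "(\<forall>p \<alpha>. prime p \<and> \<alpha> > 0 \<and> n = m * p ^ \<alpha> \<longrightarrow>
            resultant (hom_fibotomic m) (hom_fibotomic n) =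
              monom (int p ^ totient m) (totient m * totient n))
       \<and> ((\<nexists>p \<alpha>. prime p \<and> \<alpha> > 0 \<and> n = m * p ^ \<alpha>) \<longrightarrow>
            resultant (hom_fibotomic m) (hom_fibotomic n) = monom 1 (totient m * totient n))"
proof -
  have "resultant (hom_fibotomic m) (hom_fibotomic n) =
      monom (resultant (fibotomic m) (fibotomic n)) (totient m * totient n)"
    using assms resultant_homogenize[OF monic_fibotomic, of m "fibotomic n"]
    by (simp add: hom_fibotomic_eq_homogenize degree_fibotomic)
  then show ?thesis
    using assms resultant_fibotomic_prime_power resultant_fibotomic_not_prime_power by metis
qed

end
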